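(* Let $k\ge2$ be an integer, let $q\in\mathbb{C}$ with $|q|\ne0,1$, and let $c\in\mathbb{C}$. Let $A_0,A_1,\dots,A_{k-1}$ be entire functions of zero order such that $\rho_{\log}(A_0)>\rho_{\log}(A_j)\ge1$ for $j=1,2,\dots,k-1$. Suppose that $g\not\equiv0$ is an entire solution of the linear Hahn difference equation $$\mathcal{D}_{q,c}^{k}g(z)+A_{k-1}(z)\mathcal{D}_{q,c}^{k-1}g(z)+\cdots+A_{1}(z)\mathcal{D}_{q,c}g(z)+A_{0}(z)g(z)=0.$$ Then $\rho_{\log}(g)\ge\rho_{\log}(A_0)+1$.
   Context: For $q\in\mathbb{C}\setminus\{0,1\}$, $c\in\mathbb{C}$ and $g$ meromorphic on $\mathbb{C}$, the Hahn difference operator is $\mathcal{D}_{q,c}g(z)=\frac{g(qz+c)-g(z)}{(q-1)z+c}$, with iterates $\mathcal{D}_{q,c}^{0}g=g$ and $\mathcal{D}_{q,c}^{k}g=\mathcal{D}_{q,c}(\mathcal{D}_{q,c}^{k-1}g)$ for $k\ge1$. $T(r,\cdot)$ is the Nevanlinna characteristic function. The order and logarithmic order of $f$ are $\rho(f)=\limsup_{r\to\infty}\frac{\log^{+}T(r,f)}{\log r}$ and $\rho_{\log}(f)=\limsup_{r\to\infty}\frac{\log^{+}T(r,f)}{\log\log r}$. *)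

theory Defs
  imports "HOL-Complex_Analysis.Complex_Analysis"
begin

definition log_plus :: "real \<Rightarrow> real" where
  "log_plus x = ln (max 1 x)"

definition proximity :: "real \<Rightarrow> (complex \<Rightarrow> complex) \<Rightarrow> real" where
  "proximity r f =
     integral {0..2 * pi} (\<lambda>\<theta>. log_plus (norm (f (of_real r * cis \<theta>)))) / (2 * pi)"

text \<open>
  Poles are counted with multiplicity, which is minus the order of the function at the pole.
\<close>
definition pole_count :: "real \<Rightarrow> (complex \<Rightarrow> complex) \<Rightarrow> int" where
  "pole_count t f = (\<Sum>z\<in>{z \<in> cball 0 t. is_pole f z}. - zorder f z)"

definition counting :: "real \<Rightarrow> (complex \<Rightarrow> complex) \<Rightarrow> real" where
  "counting r f =
     integral {0..r} (\<lambda>t. of_int (pole_count t f - pole_count 0 f) / t)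
       + of_int (pole_count 0 f) * ln r"

definition nevanlinna_T :: "real \<Rightarrow> (complex \<Rightarrow> complex) \<Rightarrow> real" where
  "nevanlinna_T r f = proximity r f + counting r f"

definition growth_order :: "(complex \<Rightarrow> complex) \<Rightarrow> ereal" where
  "growth_order f =
     Limsup at_top (\<lambda>r. ereal (log_plus (nevanlinna_T r f) / ln r))"

definition log_order :: "(complex \<Rightarrow> complex) \<Rightarrow> ereal" where
  "log_order f =
     Limsup at_top (\<lambda>r. ereal (log_plus (nevanlinna_T r f) / ln (ln r)))"

text \<open>
  The difference quotient is understood as a meromorphic function: where its denominator
  vanishes, namely at the fixed point of \<open>\<lambda>z. q * z + c\<close>, literal division would give \<open>0\<close>.
  Passing to \<^const>\<open>remove_sings\<close> fills in the limit wherever it exists (so for entire \<open>g\<close> the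
  result is again entire), and poles get the value \<open>0\<close>.
\<close>
definition hahn :: "complex \<Rightarrow> complex \<Rightarrow> (complex \<Rightarrow> complex) \<Rightarrow> complex \<Rightarrow> complex" where
  "hahn q c g = remove_sings (\<lambda>z. (g (q * z + c) - g z) / ((q - 1) * z + c))"

end

theory Submission
  imports Defs "HOL-Real_Asymp.Real_Asymp"
begin

text \<open>
  Suppose that \<open>\<rho>_log(g) < \<tau> + 1\<close> and \<open>\<rho>_log(A_j) < \<tau> < \<rho>_log(A_0)\<close> for \<open>j \<ge> 1\<close>. The Poisson formula, applied
  after the zeros have been reflected in the circle, turns bounds on the characteristic into bounds
  on the maximum modulus. By the maximum principle \<open>g\<close> then has only \<open>O((log R)^\<tau>)\<close> zeros in the disc
  of radius \<open>R^2\<close>, and by the Borel-Caratheodory inequality its zero-free part is almost constant on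
  discs of radius \<open>O(R)\<close>. Every interval \<open>[R, 2R]\<close> contains a radius that stays at relative distance
  \<open>1/O((log R)^\<tau>)\<close> from the moduli of these zeros. On that circle each zero contributes only
  \<open>O(log log R)\<close> to \<open>log |g(w')/g(w)|\<close>, so the quotients \<open>D^j g/g\<close> are at most \<open>exp((log R)^(\<tau>+\<epsilon>))\<close>.
  Solving the equation for \<open>A_0\<close> bounds \<open>A_0\<close> there, hence inside, which gives \<open>\<rho>_log(A_0) \<le> \<tau> + \<epsilon>\<close>.
\<close>

section \<open>Zeros, reflection, and the Poisson inequality\<close>

text \<open>The quotient is given by the local factorization near \<open>a\<close> and by plain
  division elsewhere; the two pieces agree on the overlap and glue. The exponent is 0 when
  \<open>f a\<close> is nonzero.\<close>

lemma divide_out_zero: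
  fixes f :: "complex \<Rightarrow> complex"
  assumes f: "f holomorphic_on UNIV" and nz: "\<exists>z. f z \<noteq> 0"
  shows "\<exists>g m. g holomorphic_on UNIV \<and> g a \<noteq> 0 \<and> (\<forall>z. f z = g z * (z - a) ^ m)"
proof -
  obtain m h r where r: "r > 0" "h holomorphic_on cball a r"
    "\<And>w. w \<in> cball a r \<Longrightarrow> f w = h w * (w - a) ^ m \<and> h w \<noteq> 0"
    using zorder_exist_zero[OF f open_UNIV connected_UNIV, of a] nz by auto
  define g where "g = (\<lambda>z. if z = a then h a else f z / (z - a) ^ m)"
  have eq: "g z = h z" if "z \<in> ball a r" for z
    using r(3)[of z] that by (auto simp: g_def)
  have "g holomorphic_on ball a r"
    by (rule holomorphic_transform[OF holomorphic_on_subset[OF r(2) ball_subset_cball]]) (simp add: eq)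
  moreover have "g holomorphic_on - {a}"
  proof -
    have "(\<lambda>z. f z / (z - a) ^ m) holomorphic_on - {a}"
      by (intro holomorphic_intros holomorphic_on_subset[OF f]) auto
    thus ?thesis by (rule holomorphic_transform) (auto simp: g_def)
  qed
  ultimately have "g holomorphic_on (ball a r \<union> - {a})"
    by (intro holomorphic_on_Un) auto
  moreover have "ball a r \<union> - {a} = UNIV" using r(1) by auto
  moreover have "f z = g z * (z - a) ^ m" for z
    using r(3)[of a] r(1) by (auto simp: g_def)
  moreover have "g a \<noteq> 0" using r(3)[of a] r(1) by (auto simp: g_def)
  ultimately show ?thesis by auto
qed

lemma divide_out_finite_zeros:
  fixes f :: "complex \<Rightarrow> complex"
  assumes f: "f holomorphic_on UNIV" and nz: "\<exists>z. f z \<noteq> 0" and "finite Z"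
  shows "\<exists>g n. g holomorphic_on UNIV \<and> (\<forall>a\<in>Z. g a \<noteq> 0) \<and> (\<forall>z. f z = g z * (\<Prod>a\<in>Z. (z - a) ^ n a))"
  using \<open>finite Z\<close>
proof induction
  case empty
  show ?case using f by auto
next
  case (insert b Z)
  then obtain g n where g: "g holomorphic_on UNIV" "\<forall>a\<in>Z. g a \<noteq> 0"
    "\<And>z. f z = g z * (\<Prod>a\<in>Z. (z - a) ^ n a)" by metis
  have "\<exists>z. g z \<noteq> 0" using nz g(3) by force
  then obtain h m where h: "h holomorphic_on UNIV" "h b \<noteq> 0" "\<And>z. g z = h z * (z - b) ^ m"
    using divide_out_zero[OF g(1), of b] by metis
  have "(\<Prod>a\<in>Z. (z - a) ^ (n(b := m)) a) = (\<Prod>a\<in>Z. (z - a) ^ n a)" for z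
    using insert by (intro prod.cong) auto
  then have "\<forall>z. f z = h z * (\<Prod>a\<in>insert b Z. (z - a) ^ (n(b := m)) a)"
    using insert by (simp add: g(3) h(3))
  moreover have "\<forall>a\<in>insert b Z. h a \<noteq> 0" using h(2,3) g(2) by auto
  ultimately show ?case using h(1) by blast
qed

lemma finite_zeros_cball:
  fixes f :: "complex \<Rightarrow> complex"
  assumes f: "f holomorphic_on UNIV" and nz: "\<exists>z. f z \<noteq> 0"
  shows "finite {z\<in>cball 0 R. f z = 0}"
proof (cases "f constant_on UNIV")
  case True
  then have "{z\<in>cball 0 R. f z = 0} = {}" using nz by (auto simp: constant_on_def)
  then show ?thesis by (metis finite.emptyI)
next
  case False
  then show ?thesis
    by (intro holomorphic_compact_finite_zeros[OF f]) auto
qed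

text \<open>
  The denominators of the Blaschke factors: on the circle of radius \<open>R\<close> the factor belonging to
  \<open>a\<close> has the same modulus as \<open>z - a\<close>, but its zero is the mirror image \<open>R^2 / cnj a\<close>.
\<close>
definition reflected :: "real \<Rightarrow> complex set \<Rightarrow> (complex \<Rightarrow> nat) \<Rightarrow> complex \<Rightarrow> complex" where
  "reflected R Z n z = (\<Prod>a\<in>Z. ((of_real (R\<^sup>2) - cnj a * z) / of_real R) ^ n a)"

lemma reflected_holomorphic [holomorphic_intros]: "R \<noteq> 0 \<Longrightarrow> reflected R Z n holomorphic_on S"
  unfolding reflected_def[abs_def] by (intro holomorphic_intros) auto

lemma norm_reflected_sphere:
  assumes "norm z = R" "R > 0"
  shows "norm (reflected R Z n z) = norm (\<Prod>a\<in>Z. (z - a) ^ n a)"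
proof -
  have "norm ((of_real (R\<^sup>2) - cnj a * z) / of_real R) = norm (z - a)" for a
  proof -
    have "of_real (R\<^sup>2) - cnj a * z = z * cnj (z - a)"
      using assms(1) by (simp add: algebra_simps complex_norm_square[symmetric])
    then show ?thesis using assms by (simp add: norm_mult norm_divide del: complex_cnj_diff)
  qed
  then show ?thesis by (simp add: reflected_def prod_norm[symmetric] norm_power)
qed

text \<open>Blaschke factors have modulus at most 1 in the disc: the difference of the two squared
  moduli, scaled by \<open>R^2\<close>, factors as
  \<open>(R^2 - |z|^2) (R^2 - |a|^2)\<close>.\<close>

lemma reflected_factor_ge:
  assumes "norm z \<le> R" "norm a \<le> R" "R > 0"
  shows "norm (z - a) \<le> norm ((of_real (R\<^sup>2) - cnj a * z) / of_real R)"
proof -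
  have "0 \<le> (R\<^sup>2 - (norm z)\<^sup>2) * (R\<^sup>2 - (norm a)\<^sup>2)"
    using assms by (intro mult_nonneg_nonneg) (auto simp: power_mono)
  also have "\<dots> = (norm (of_real (R\<^sup>2) - cnj a * z))\<^sup>2 - (R * norm (z - a))\<^sup>2"
    unfolding power_mult_distrib cmod_power2 by (simp add: power2_eq_square algebra_simps)
  finally have "(R * norm (z - a))\<^sup>2 \<le> (norm (of_real (R\<^sup>2) - cnj a * z))\<^sup>2"
    by (simp only: diff_ge_0_iff_ge)
  then have "R * norm (z - a) \<le> norm (of_real (R\<^sup>2) - cnj a * z)"
    by (rule power2_le_imp_le) (rule norm_ge_zero)
  then show ?thesis using assms by (simp add: norm_divide field_simps)
qed

lemma norm_reflected_ge:
  assumes "norm z \<le> R" "Z \<subseteq> cball 0 R" "R > 0"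
  shows "norm (\<Prod>a\<in>Z. (z - a) ^ n a) \<le> norm (reflected R Z n z)"
  unfolding reflected_def prod_norm[symmetric] norm_power
  using assms by (intro prod_mono conjI power_mono reflected_factor_ge) auto

text \<open>The zero \<open>R^2 / cnj a\<close> of a factor has modulus at least \<open>R\<close>,
  with equality only for \<open>norm a = R\<close>. So either \<open>z\<close> or all of
  \<open>Z\<close> must stay off the circle. Both alternatives are used: open disc with zeros
  possibly on the rim, and closed disc with a rim free of zeros.\<close>

lemma reflected_nonzero:
  assumes "norm z \<le> R" "Z \<subseteq> cball 0 R" "norm z < R \<or> Z \<subseteq> ball 0 R" "R > 0" "finite Z"
  shows "reflected R Z n z \<noteq> 0"
proof -
  have "of_real (R\<^sup>2) - cnj a * z \<noteq> 0" if "a \<in> Z" for a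
  proof
    have a: "norm a \<le> R" "norm z < R \<or> norm a < R" using that assms by auto
    assume "of_real (R\<^sup>2) - cnj a * z = 0"
    then have "of_real (R\<^sup>2) = cnj a * z" by simp
    then have "norm (cnj a * z) = norm (of_real (R\<^sup>2) :: complex)" by (simp only:)
    then have "norm a * norm z = R * R" by (simp add: norm_mult power2_eq_square norm_power)
    moreover have "norm a * norm z < R * R"
    proof (cases "norm z < R")
      case True
      then have "norm a * norm z \<le> R * norm z" using a by (intro mult_right_mono) auto
      also have "\<dots> < R * R" using True assms(4) by simp
      finally show ?thesis .
    next
      case False
      then have "norm a * norm z \<le> norm a * R" using assms by (intro mult_left_mono) auto
      also have "\<dots> < R * R" using False a assms(4) by simp
      finally show ?thesis .
    qed
    ultimately show False by simp
  qed
  then show ?thesis using assms by (simp add: reflected_def)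
qed

section \<open>Maximum modulus and Nevanlinna characteristic of entire functions\<close>

lemma max_modulus_cball:
  fixes f :: "complex \<Rightarrow> complex"
  assumes "f holomorphic_on UNIV" "r > 0" "\<And>w. norm (w - z0) = r \<Longrightarrow> norm (f w) \<le> B" "norm (z - z0) \<le> r"
  shows "norm (f z) \<le> B"
proof (rule maximum_modulus_frontier[of f "cball z0 r"])
  show "f holomorphic_on interior (cball z0 r)" "continuous_on (closure (cball z0 r)) f"
    using assms(1) holomorphic_on_subset holomorphic_on_imp_continuous_on by blast+
qed (use assms in \<open>auto simp: dist_norm norm_minus_commute frontier_cball\<close>)

lemma log_plus_ge_0 [simp]: "0 \<le> log_plus x"
  by (simp add: log_plus_def)

lemma ln_le_log_plus: "x > 0 \<Longrightarrow> ln x \<le> log_plus x"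
  by (simp add: log_plus_def)

lemma continuous_on_log_plus [continuous_intros]:
  "continuous_on S f \<Longrightarrow> continuous_on S (\<lambda>x. log_plus (f x))"
  unfolding log_plus_def by (intro continuous_intros) (auto simp: max_def)

lemma nevanlinna_T_entire:
  assumes "f holomorphic_on UNIV"
  shows "nevanlinna_T r f = proximity r f"
proof -
  have "\<not> is_pole f z" for z
    using not_is_pole_holomorphic[OF open_UNIV UNIV_I assms] .
  then show ?thesis by (simp add: nevanlinna_T_def counting_def pole_count_def)
qed

text \<open>In the Poisson formula for \<open>Re h\<close>, the kernel is bounded by its maximum on
  the circle and \<open>Re h\<close> by \<open>log_plus (norm (exp h))\<close>. The form with
  \<open>exp h\<close> suits a logarithm \<open>h\<close> of a zero-free function.\<close>

lemma Re_le_proximity_exp: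
  assumes h: "h holomorphic_on ball 0 R'" and "R < R'" "norm z < R"
  shows "Re (h z) \<le> (R + norm z) / (R - norm z) * proximity R (\<lambda>w. exp (h w))"
proof -
  define P where "P = (\<lambda>t. (R\<^sup>2 - (norm z)\<^sup>2) / (norm (of_real R * cis t - z))\<^sup>2)"
  define k where "k = (R + norm z) / (R - norm z)"
  have R: "R > 0" using assms(3) norm_ge_zero[of z] by linarith
  have sub: "cball 0 R \<subseteq> ball 0 R'" using assms by auto
  \<comment> \<open>The only possible pole \<open>R^2 / cnj z\<close> of the auxiliary function
    below lies outside the closed disc.\<close>
  have nz: "of_real (R\<^sup>2) - cnj z * u \<noteq> 0" if "norm u \<le> R" for u
  proof
    assume "of_real (R\<^sup>2) - cnj z * u = 0"
    then have "of_real (R\<^sup>2) = cnj z * u" by simp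
    then have "norm (cnj z * u) = norm (of_real (R\<^sup>2) :: complex)" by (simp only:)
    then have "norm z * norm u = R * R" by (simp add: norm_mult power2_eq_square norm_power)
    moreover have "norm z * norm u \<le> norm z * R" using that by (intro mult_left_mono) auto
    moreover have "norm z * R < R * R" using assms R by simp
    ultimately show False by simp
  qed
  \<comment> \<open>Cauchy's formula for \<open>f\<close> at \<open>z\<close>, parametrised by the angle, is Poisson's formula for \<open>h\<close>.\<close>
  define f where "f = (\<lambda>u. h u * of_real (R\<^sup>2 - (norm z)\<^sup>2) / (of_real (R\<^sup>2) - cnj z * u))"
  have holf: "f holomorphic_on cball 0 R"
    unfolding f_def using nz by (intro holomorphic_intros holomorphic_on_subset[OF h sub]) auto
  have ct: "continuous_on {0..2*pi} (\<lambda>t. h (of_real R * cis t))"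
    by (rule continuous_on_compose2[OF holomorphic_on_imp_continuous_on[OF h]])
       (use R assms in \<open>auto intro!: continuous_intros simp: norm_mult\<close>)
  have fz: "f z = h z"
  proof -
    have "of_real (R\<^sup>2) - cnj z * z = (of_real (R\<^sup>2 - (norm z)\<^sup>2) :: complex)"
      by (simp only: of_real_diff complex_norm_square mult.commute)
    then show ?thesis using nz[of z] assms by (simp add: f_def)
  qed
  have "((\<lambda>u. f u / (u - z)) has_contour_integral (2 * of_real pi * \<i> * f z)) (circlepath 0 R)"
    using assms holf
    by (intro Cauchy_integral_circlepath)
       (auto intro: holomorphic_on_imp_continuous_on holomorphic_on_subset ball_subset_cball)
  then have "((\<lambda>t. f (of_real R * cis t) / (of_real R * cis t - z) * R * \<i> * cis t)
        has_integral (2 * of_real pi * \<i> * h z)) {0..2*pi}"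
    unfolding circlepath_def by (subst (asm) has_contour_integral_part_circlepath_iff) (auto simp: fz)
  also have "(\<lambda>t. f (of_real R * cis t) / (of_real R * cis t - z) * R * \<i> * cis t) =
      (\<lambda>t. \<i> * (of_real (P t) * h (of_real R * cis t)))"
  proof
    fix t
    define w where "w = of_real R * cis t"
    have nw: "norm w = R" using R by (simp add: w_def norm_mult)
    have w: "w \<noteq> 0" "w - z \<noteq> 0" using nw R assms by auto
    have "of_real (R\<^sup>2) - cnj z * w = w * cnj (w - z)"
      using nw by (simp add: algebra_simps complex_norm_square[symmetric])
    moreover have "of_real ((norm (w - z))\<^sup>2) = (w - z) * cnj (w - z)"
      by (rule complex_norm_square)
    moreover have "cnj (w - z) \<noteq> 0" using w by (metis complex_cnj_zero_iff)
    ultimately have "f w / (w - z) * \<i> * w = \<i> * (of_real (P t) * h w)"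
      unfolding f_def P_def w_def[symmetric] of_real_divide using w
      by (simp add: divide_simps del: complex_cnj_diff of_real_power of_real_diff)
    then show "f (of_real R * cis t) / (of_real R * cis t - z) * R * \<i> * cis t =
       \<i> * (of_real (P t) * h (of_real R * cis t))"
      by (simp add: w_def mult_ac)
  qed
  finally have "((\<lambda>t. - \<i> * (\<i> * (of_real (P t) * h (of_real R * cis t))))
        has_integral (- \<i> * (2 * of_real pi * \<i> * h z))) {0..2*pi}"
    by (rule has_integral_mult_right)
  moreover have "- \<i> * (2 * of_real pi * \<i> * h z) = 2 * of_real pi * h z"
    by (simp add: complex_eq_iff)
  ultimately have "((\<lambda>t. - \<i> * (\<i> * (of_real (P t) * h (of_real R * cis t))))
        has_integral (2 * of_real pi * h z)) {0..2*pi}"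
    by (simp only:)
  then have "((\<lambda>t. of_real (P t) * h (of_real R * cis t)) has_integral (2 * of_real pi * h z)) {0..2*pi}"
    by simp
  from has_integral_linear[OF this bounded_linear_Re]
  have I: "((\<lambda>t. P t * Re (h (of_real R * cis t))) has_integral (2 * pi * Re (h z))) {0..2*pi}"
    by (simp add: o_def)
  define J where "J = (\<lambda>t. log_plus (norm (exp (h (of_real R * cis t)))))"
  have "J integrable_on {0..2*pi}" unfolding J_def
    by (intro integrable_continuous_interval continuous_intros ct)
  then have J: "((\<lambda>t. k * J t) has_integral (k * integral {0..2*pi} J)) {0..2*pi}"
    by (intro has_integral_mult_right integrable_integral)
  \<comment> \<open>The kernel is nonnegative and at most \<open>k\<close>, since \<open>z\<close>
    has distance at least \<open>R - norm z\<close> from the circle. As \<open>Re h\<close> may be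
    negative, it is first replaced by \<open>J\<close>.\<close>
  have "P t * Re (h (of_real R * cis t)) \<le> k * J t" for t
  proof -
    have d: "R - norm z \<le> norm (of_real R * cis t - z)"
      using norm_triangle_ineq2[of "of_real R * cis t" z] R by (simp add: norm_mult)
    have P0: "0 \<le> P t" unfolding P_def using assms by (simp add: power_mono)
    have "P t \<le> (R\<^sup>2 - (norm z)\<^sup>2) / (R - norm z)\<^sup>2"
      unfolding P_def using assms d by (intro divide_left_mono power_mono mult_pos_pos) (auto simp: power_mono)
    also have "\<dots> = k" unfolding k_def using assms
      by (simp add: divide_simps) (simp add: power2_eq_square algebra_simps)
    finally have "P t \<le> k" .
    moreover have "Re (h (of_real R * cis t)) \<le> J t"
      using ln_le_log_plus[of "norm (exp (h (of_real R * cis t)))"] by (simp add: J_def)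
    moreover have "0 \<le> J t" by (simp add: J_def)
    ultimately show ?thesis using P0
      by (meson mult_left_mono mult_right_mono order_trans)
  qed
  then have "2 * pi * Re (h z) \<le> k * integral {0..2*pi} J"
    by (intro has_integral_le[OF I J])
  then show ?thesis unfolding proximity_def k_def[symmetric] J_def[symmetric]
    by (simp add: field_simps)
qed

text \<open>The Poisson inequality needs a logarithm on a disc larger than the closed one.
  Compactness gives the margin: the closed disc has positive distance from the zero set.\<close>

lemma nonvanishing_extend_ball:
  fixes F :: "complex \<Rightarrow> complex"
  assumes F: "F holomorphic_on UNIV" and nz: "\<And>z. norm z \<le> R \<Longrightarrow> F z \<noteq> 0" and "R > 0"
  obtains R' where "R < R'" "\<And>z. norm z < R' \<Longrightarrow> F z \<noteq> 0"
proof -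
  have "closed (F -` {0})"
    using F by (intro closed_vimage) (auto simp: holomorphic_on_imp_continuous_on continuous_on_eq_continuous_at)
  moreover have disj: "cball 0 R \<inter> F -` {0} = {}"
    using nz by (auto simp del: vimage_singleton_eq simp: vimage_def)
  ultimately obtain d where d: "d > 0" "\<forall>x\<in>cball 0 R. \<forall>y\<in>F -` {0}. d \<le> dist x y"
    using separate_compact_closed[of "cball 0 R" "F -` {0}"] disj by auto
  have "F z \<noteq> 0" if "norm z < R + d" for z
  proof
    assume z: "F z = 0"
    then have zR: "norm z > R" using nz[of z] by linarith
    have z0: "z \<noteq> 0" using zR \<open>R > 0\<close> by auto
    \<comment> \<open>The radial projection of \<open>z\<close> onto the circle, at distance
      \<open>norm z - R\<close> from \<open>z\<close>.\<close>
    define x where "x = of_real (R / norm z) * z"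
    have "norm x = R" using zR \<open>R > 0\<close> unfolding x_def norm_mult norm_of_real by auto
    then have "d \<le> dist x z" using d z by auto
    also have "x - z = of_real (R / norm z - 1) * z" by (simp add: x_def algebra_simps)
    then have "dist x z = \<bar>R / norm z - 1\<bar> * norm z"
      unfolding dist_norm by (simp only: norm_mult norm_of_real)
    also have "\<dots> = norm z - R" using zR \<open>R > 0\<close> z0 by (simp add: abs_if field_simps)
    finally show False using that by simp
  qed
  then show ?thesis using that[of "R + d"] d(1) by auto
qed

text \<open>Reflecting the zeros gives a zero-free function with the same modulus on the circle of
  radius \<open>R\<close> and no smaller modulus inside, and the Poisson inequality applies to its
  logarithm. For this the circle must miss the finitely many zeros, so \<open>R\<close> is only
  located in an interval.\<close>

lemma norm_le_exp_nevanlinna_T: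
  fixes f :: "complex \<Rightarrow> complex"
  assumes f: "f holomorphic_on UNIV" and r: "r > 0"
  shows "\<exists>R. 2 * r \<le> R \<and> R \<le> 3 * r \<and> (\<forall>z. norm z \<le> r \<longrightarrow> norm (f z) \<le> exp (3 * nevanlinna_T R f))"
proof (cases "\<exists>z. f z \<noteq> 0")
  case False
  then show ?thesis using r by (intro exI[of _ "2*r"]) auto
next
  case True
  have "finite (norm ` {z\<in>cball 0 (3*r). f z = 0})"
    using finite_zeros_cball[OF f True] by blast
  moreover have "infinite {2*r..3*r}" using r by (simp add: infinite_Icc)
  ultimately obtain R where R: "R \<in> {2*r..3*r}" "R \<notin> norm ` {z\<in>cball 0 (3*r). f z = 0}"
    by (meson finite_subset subsetI)
  have R0: "R > 0" using R r by auto
  define Z where "Z = {z\<in>cball 0 R. f z = 0}"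
  have Z: "finite Z" unfolding Z_def by (rule finite_zeros_cball[OF f True])
  obtain G n where G: "G holomorphic_on UNIV" "\<forall>a\<in>Z. G a \<noteq> 0" "\<And>z. f z = G z * (\<Prod>a\<in>Z. (z - a) ^ n a)"
    using divide_out_finite_zeros[OF f True Z] by metis
  define F where "F = (\<lambda>z. G z * reflected R Z n z)"
  have F: "F holomorphic_on UNIV" unfolding F_def using R0 by (intro holomorphic_intros G) auto
  have ZR: "Z \<subseteq> cball 0 R" "Z \<subseteq> ball 0 R" using R by (force simp: Z_def)+
  have "G z \<noteq> 0" if "norm z \<le> R" for z
  proof (cases "z \<in> Z")
    case False
    then have "f z \<noteq> 0" using that by (simp add: Z_def)
    then show ?thesis by (metis G(3) mult_zero_left)
  qed (use G(2) in blast)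
  then have "F z \<noteq> 0" if "norm z \<le> R" for z
    using reflected_nonzero[OF that ZR(1) _ R0 Z] ZR(2) that by (simp add: F_def)
  then obtain R' where R': "R < R'" "\<And>z. norm z < R' \<Longrightarrow> F z \<noteq> 0"
    using nonvanishing_extend_ball[OF F _ R0] by metis
  obtain h where h: "h holomorphic_on ball 0 R'" "\<And>z. z \<in> ball 0 R' \<Longrightarrow> exp (h z) = F z"
    using holomorphic_logarithm_exists[OF convex_ball open_ball holomorphic_on_subset[OF F subset_UNIV], of 0 R' 0]
      R' R0 by auto
  have prox: "proximity R (\<lambda>w. exp (h w)) = nevanlinna_T R f"
  proof -
    have "norm (exp (h (of_real R * cis t))) = norm (f (of_real R * cis t))" for t
      using h(2)[of "of_real R * cis t"] R' R0 norm_reflected_sphere[of "of_real R * cis t" R Z n]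
      by (simp add: norm_mult F_def G(3))
    then show ?thesis by (simp add: nevanlinna_T_entire[OF f] proximity_def)
  qed
  have T0: "0 \<le> nevanlinna_T R f"
    by (auto simp: nevanlinna_T_entire[OF f] proximity_def intro!: divide_nonneg_pos integral_nonneg
       integrable_continuous_interval continuous_intros
       continuous_on_compose2[OF holomorphic_on_imp_continuous_on[OF f]])
  have "norm (f z) \<le> exp (3 * nevanlinna_T R f)" if z: "norm z \<le> r" for z
  proof -
    \<comment> \<open>At most half the radius, so the Poisson factor
      \<open>(R + norm z) / (R - norm z)\<close> is at most 3.\<close>
    have zR: "norm z \<le> R / 2" using z R by auto
    have "norm (f z) \<le> norm (F z)"
      unfolding G(3) F_def norm_mult using zR R0
      by (intro mult_left_mono norm_reflected_ge ZR) auto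
    also have "\<dots> = exp (Re (h z))" using h(2)[of z] zR R0 R' by (simp flip: norm_exp_eq_Re)
    also have "Re (h z) \<le> (R + norm z) / (R - norm z) * nevanlinna_T R f"
      using Re_le_proximity_exp[OF h(1) R'(1), of z] zR R0 prox by simp
    also have "\<dots> \<le> 3 * nevanlinna_T R f"
      using zR R0 T0 by (intro mult_right_mono) (auto simp: divide_simps)
    finally show ?thesis by simp
  qed
  then show ?thesis using R by auto
qed

lemma nevanlinna_T_le:
  assumes f: "f holomorphic_on UNIV" and "\<And>z. norm z = r \<Longrightarrow> norm (f z) \<le> exp L" and "0 \<le> L" "r \<ge> 0"
  shows "nevanlinna_T r f \<le> L"
proof -
  have "integral {0..2*pi} (\<lambda>\<theta>. log_plus (norm (f (of_real r * cis \<theta>)))) \<le> integral {0..2*pi} (\<lambda>_. L)"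
  proof (rule integral_le)
    show "log_plus (norm (f (of_real r * cis t))) \<le> L" for t
    proof -
      have "max 1 (norm (f (of_real r * cis t))) \<le> exp L"
        using assms(2)[of "of_real r * cis t"] assms(3,4) by (simp add: norm_mult)
      then have "ln (max 1 (norm (f (of_real r * cis t)))) \<le> ln (exp L)"
        by (subst ln_le_cancel_iff) auto
      then show ?thesis by (simp add: log_plus_def)
    qed
  qed (auto intro!: integrable_continuous_interval continuous_intros
       continuous_on_compose2[OF holomorphic_on_imp_continuous_on[OF f]])
  then show ?thesis by (simp add: nevanlinna_T_entire[OF f] proximity_def field_simps)
qed

section \<open>Quotients of values of an entire function of finite logarithmic order\<close>

text \<open>The rescaled difference \<open>u\<close> takes values in the half-plane
  \<open>Re < A\<close>, which \<open>u / (2 * A - u)\<close> maps into the unit disc fixing 0. The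
  Schwarz lemma bounds this quotient by \<open>norm w\<close>, and solving for \<open>u\<close>
  gives the claim.\<close>

lemma borel_caratheodory:
  fixes h :: "complex \<Rightarrow> complex"
  assumes h: "h holomorphic_on ball 0 \<rho>" and lt: "\<And>z. norm z < \<rho> \<Longrightarrow> Re (h z) - Re (h 0) < A"
    and z: "norm z < \<rho>"
  shows "norm (h z - h 0) \<le> 2 * A * norm z / (\<rho> - norm z)"
proof -
  have \<rho>: "\<rho> > 0" using z norm_ge_zero[of z] by linarith
  have A: "A > 0" using lt[of 0] \<rho> by simp
  define u where "u = (\<lambda>w. h (of_real \<rho> * w) - h 0)"
  have Reu: "Re (u w) < A" if "norm w < 1" for w
    using lt[of "of_real \<rho> * w"] that \<rho> by (simp add: u_def norm_mult)
  have lt2: "norm (u w) < norm (2 * of_real A - u w)" if "norm w < 1" for w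
  proof -
    have "(norm (2 * of_real A - u w))\<^sup>2 - (norm (u w))\<^sup>2 = 4 * A * (A - Re (u w))"
      unfolding cmod_power2 by (simp add: power2_eq_square algebra_simps)
    also have "\<dots> > 0" using A Reu[OF that] by simp
    finally have "(norm (u w))\<^sup>2 < (norm (2 * of_real A - u w))\<^sup>2" by simp
    then show ?thesis by (rule power2_less_imp_less) simp
  qed
  define \<phi> where "\<phi> = (\<lambda>w. u w / (2 * of_real A - u w))"
  have im: "(\<lambda>w::complex. of_real \<rho> * w) ` ball 0 1 \<subseteq> ball 0 \<rho>"
    using \<rho> by (auto simp: norm_mult)
  have "(\<lambda>w. h (of_real \<rho> * w)) holomorphic_on ball 0 1"
    by (rule holomorphic_on_compose_gen[OF _ h im, unfolded o_def]) (intro holomorphic_intros)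
  then have u: "u holomorphic_on ball 0 1"
    unfolding u_def by (intro holomorphic_intros)
  have ne: "2 * of_real A - u w \<noteq> 0" if "norm w < 1" for w
    using lt2[OF that] by auto
  have "\<phi> holomorphic_on ball 0 1"
    unfolding \<phi>_def using ne by (intro holomorphic_intros u) auto
  moreover have "\<phi> 0 = 0" by (simp add: \<phi>_def u_def)
  moreover have "norm (\<phi> w) < 1" if "norm w < 1" for w
    using lt2[OF that] ne[OF that] by (simp add: \<phi>_def norm_divide)
  moreover define w where "w = z / of_real \<rho>"
  have w: "norm w < 1" using z \<rho> by (simp add: w_def norm_divide)
  ultimately have "norm (\<phi> w) \<le> norm w" using Schwarz_Lemma(1) by blast
  then have "norm (u w) \<le> norm w * norm (2 * of_real A - u w)"
    using ne[OF w] by (simp add: \<phi>_def norm_divide divide_le_eq)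
  also have "\<dots> \<le> norm w * (2 * A + norm (u w))"
    using norm_triangle_ineq4[of "2 * of_real A" "u w"] A
    by (intro mult_left_mono) (auto simp: norm_mult)
  finally have "norm (u w) * (1 - norm w) \<le> 2 * A * norm w"
    by (simp add: algebra_simps)
  moreover have "norm w = norm z / \<rho>" using \<rho> by (simp add: w_def norm_divide)
  moreover have "u w = h z - h 0" using \<rho> by (simp add: u_def w_def)
  moreover have "norm (h z - h 0) * (\<rho> - norm z) = norm (h z - h 0) * (1 - norm z / \<rho>) * \<rho>"
    "2 * A * norm z = 2 * A * (norm z / \<rho>) * \<rho>"
    using \<rho> by (simp_all add: algebra_simps)
  ultimately have "norm (h z - h 0) * (\<rho> - norm z) \<le> 2 * A * norm z"
    using \<rho> by (simp only: mult_right_mono less_imp_le)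
  then show ?thesis using z by (simp add: field_simps)
qed

text \<open>Jensen's inequality in exponential form. Zeros in radius \<open>\<rho>\<close> are
  reflected in the circle of radius \<open>\<rho>^2\<close>. At 0 each linear factor has modulus at
  most \<open>\<rho>\<close> and its reflection has modulus \<open>\<rho>^2\<close>, so every zero
  gains a factor \<open>\<rho>\<close>, while the maximum principle keeps the reflected function
  below \<open>M\<close>.\<close>

lemma zero_count_bound:
  assumes G: "G holomorphic_on UNIV" and f: "\<And>z. f z = G z * (\<Prod>a\<in>Z. (z - a) ^ n a)"
    and Z: "Z \<subseteq> cball 0 \<rho>" and \<rho>: "\<rho> > 1" and M: "\<And>z. norm z \<le> \<rho>\<^sup>2 \<Longrightarrow> norm (f z) \<le> M"
  shows "norm (f 0) * \<rho> ^ (\<Sum>a\<in>Z. n a) \<le> M"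
proof -
  have \<rho>2: "\<rho>\<^sup>2 > 0" using \<rho> by simp
  have "norm (\<Prod>a\<in>Z. (0 - a) ^ n a) \<le> (\<Prod>a\<in>Z. \<rho> ^ n a)"
    unfolding prod_norm[symmetric] norm_power
    using Z by (intro prod_mono conjI power_mono) auto
  then have "norm (f 0) \<le> norm (G 0) * \<rho> ^ (\<Sum>a\<in>Z. n a)"
    unfolding f norm_mult power_sum by (intro mult_left_mono) auto
  then have "norm (f 0) * \<rho> ^ (\<Sum>a\<in>Z. n a) \<le> norm (G 0) * \<rho> ^ (\<Sum>a\<in>Z. n a) * \<rho> ^ (\<Sum>a\<in>Z. n a)"
    using \<rho> by (intro mult_right_mono) auto
  also have "\<dots> = norm (G 0 * reflected (\<rho>\<^sup>2) Z n 0)"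
    using \<rho> by (simp add: reflected_def norm_mult norm_power prod_norm[symmetric] power_sum[symmetric]
        norm_divide power2_eq_square power_mult_distrib prod.distrib)
  also have "\<dots> \<le> M"
  proof (rule max_modulus_cball[where f = "\<lambda>z. G z * reflected (\<rho>\<^sup>2) Z n z" and ?z0.0 = 0])
    show "(\<lambda>z. G z * reflected (\<rho>\<^sup>2) Z n z) holomorphic_on UNIV"
      using \<rho>2 by (intro holomorphic_intros G) auto
    show "norm (G w * reflected (\<rho>\<^sup>2) Z n w) \<le> M" if "norm (w - 0) = \<rho>\<^sup>2" for w
      using M[of w] that norm_reflected_sphere[of w "\<rho>\<^sup>2" Z n] \<rho>2 by (simp add: norm_mult f)
  qed (use \<rho>2 in auto)
  finally show ?thesis .
qed

text \<open>Pigeonhole: among \<open>N + 1\<close> points of \<open>[R, 2R]\<close> with spacing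
  \<open>R / (N + 1)\<close>, one is at least half a spacing away from \<open>S\<close>. Otherwise
  each would have its own element of \<open>S\<close> nearby, and \<open>S\<close> would have more
  than \<open>N\<close> elements.\<close>

lemma ex_radius_avoiding:
  fixes S :: "real set"
  assumes S: "finite S" "card S \<le> N" and R: "R > 0"
  shows "\<exists>r. R \<le> r \<and> r \<le> 2 * R \<and> (\<forall>s\<in>S. R / (2 * (real N + 1)) \<le> \<bar>r - s\<bar>)"
proof (rule ccontr)
  assume neg: "\<not> ?thesis"
  define p where "p = (\<lambda>i::nat. R + i * (R / (real N + 1)))"
  have "\<exists>s\<in>S. \<bar>p i - s\<bar> < R / (2 * (real N + 1))" if "i \<le> N" for i
  proof -
    have "real i * (R / (real N + 1)) \<le> (real N + 1) * (R / (real N + 1))"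
      using that R by (intro mult_right_mono) auto
    then have "p i \<le> 2 * R" "R \<le> p i" using R by (auto simp: p_def)
    then show ?thesis using neg by (meson not_le)
  qed
  then obtain \<sigma> where \<sigma>: "\<And>i. i \<le> N \<Longrightarrow> \<sigma> i \<in> S \<and> \<bar>p i - \<sigma> i\<bar> < R / (2 * (real N + 1))" by metis
  have "inj_on \<sigma> {..N}"
  proof (rule inj_onI)
    fix i j assume ij: "i \<in> {..N}" "j \<in> {..N}" "\<sigma> i = \<sigma> j"
    have "\<bar>p i - p j\<bar> < R / (2 * (real N + 1)) + R / (2 * (real N + 1))"
      using \<sigma>[of i] \<sigma>[of j] ij by auto
    also have "\<dots> = R / (real N + 1)"
      using field_sum_of_halves[of "R / (real N + 1)"] by (simp add: mult.commute)
    finally have "\<bar>p i - p j\<bar> < R / (real N + 1)" .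
    moreover have "p i - p j = (real i - real j) * (R / (real N + 1))"
      unfolding p_def by (simp only: left_diff_distrib add_diff_cancel_left)
    ultimately have "\<bar>real i - real j\<bar> * (R / (real N + 1)) < 1 * (R / (real N + 1))"
      using R by (simp add: abs_mult)
    then have "\<bar>real i - real j\<bar> < 1" using R by (subst (asm) mult_less_cancel_right_pos) auto
    then show "i = j" by linarith
  qed
  then have "card {..N} \<le> card S"
    using \<sigma> by (intro card_inj_on_le[of \<sigma>] S(1)) auto
  then show False using S(2) by simp
qed

text \<open>Three scales are used: the points lie within \<open>O(R)\<close>, the zeros up to
  \<open>\<rho> = R^2\<close> are reflected, and growth is known up to
  \<open>R^4 = \<rho>^2\<close>. The exponential factor is the variation of the zero-free part,
  small because \<open>R\<close> is small against \<open>\<rho>\<close>; each of the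
  \<open>N\<close> zeros, counted with multiplicity, costs one factor of the power.\<close>

lemma quotient_bound:
  fixes g :: "complex \<Rightarrow> complex"
  assumes g: "g holomorphic_on UNIV" and g0: "g 0 \<noteq> 0" and K: "K \<ge> 1" and R: "R \<ge> 4 * K"
    and L: "\<And>z. norm z \<le> R ^ 4 \<Longrightarrow> norm (g z) \<le> exp L"
  defines "A \<equiv> L - ln (norm (g 0)) + 1"
  shows "\<exists>r N. R \<le> r \<and> r \<le> 2 * R \<and> real N * (2 * ln R) \<le> A \<and>
    (\<forall>w w'. norm w = r \<longrightarrow> norm w' \<le> K * r \<longrightarrow>
       norm (g w') \<le> exp (16 * A * K / R) * (3 * (1 + 4 * (K + 1) * (real N + 1))) ^ N * norm (g w))"
proof -
  define \<rho> where "\<rho> = R\<^sup>2"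
  have R4: "R \<ge> 4" using K R by linarith
  have \<rho>R: "\<rho> \<ge> 4 * K * R" using R R4 by (simp add: \<rho>_def power2_eq_square)
  have "4 * 1 * R \<le> 4 * K * R" using K R4 by (intro mult_right_mono mult_left_mono) auto
  then have \<rho>1: "\<rho> > 1" using \<rho>R R4 by linarith
  have \<rho>4: "\<rho>\<^sup>2 = R ^ 4" by (simp add: \<rho>_def)
  have "\<rho> * 1 \<le> \<rho> * \<rho>" using \<rho>1 by (intro mult_left_mono) auto
  then have \<rho>\<rho>: "\<rho> \<le> R ^ 4" by (simp add: \<rho>4[symmetric] power2_eq_square)
  have ex: "\<exists>z. g z \<noteq> 0" using g0 by blast
  define Z where "Z = {z\<in>cball 0 \<rho>. g z = 0}"
  have fZ: "finite Z" unfolding Z_def by (rule finite_zeros_cball[OF g ex])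
  have Z: "Z \<subseteq> cball 0 \<rho>" by (auto simp: Z_def)
  obtain G n where G: "G holomorphic_on UNIV" "\<forall>a\<in>Z. G a \<noteq> 0" "\<And>z. g z = G z * (\<Prod>a\<in>Z. (z - a) ^ n a)"
    using divide_out_finite_zeros[OF g ex fZ] by metis
  define N where "N = (\<Sum>a\<in>Z. n a)"
  have lnA: "ln (norm (g 0)) \<le> L"
    using L[of 0] g0 R4 by (subst ln_exp[symmetric], subst ln_le_cancel_iff) auto
  have N: "real N * (2 * ln R) \<le> A"
  proof -
    have "norm (g 0) * \<rho> ^ N \<le> exp L"
      unfolding N_def using L \<rho>1 by (intro zero_count_bound[OF G(1,3) Z]) (auto simp: \<rho>4)
    then have "ln (norm (g 0) * \<rho> ^ N) \<le> ln (exp L)"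
      using g0 \<rho>1 by (subst ln_le_cancel_iff) auto
    then show ?thesis using g0 \<rho>1 R4 by (simp add: ln_mult ln_realpow A_def \<rho>_def)
  qed
  \<comment> \<open>Since \<open>G\<close> does not vanish on \<open>Z\<close>, every exponent is at
    least 1; hence at most \<open>N\<close> moduli have to be avoided.\<close>
  have "card Z \<le> N"
  proof -
    have "1 \<le> n a" if "a \<in> Z" for a
    proof (rule ccontr)
      assume "\<not> 1 \<le> n a"
      then have "(\<Prod>b\<in>Z. (a - b) ^ n b) \<noteq> 0" using fZ by auto
      then have "g a \<noteq> 0" using G(2) that by (simp only: G(3)) simp
      then show False using that by (simp add: Z_def)
    qed
    then have "(\<Sum>a\<in>Z. 1) \<le> N" unfolding N_def by (intro sum_mono) auto
    then show ?thesis by simp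
  qed
  moreover have "card (norm ` Z) \<le> card Z" by (rule card_image_le[OF fZ])
  ultimately obtain r where r: "R \<le> r" "r \<le> 2 * R" "\<And>a. a \<in> Z \<Longrightarrow> R / (2 * (real N + 1)) \<le> \<bar>r - norm a\<bar>"
    using ex_radius_avoiding[of "norm ` Z" N R] fZ R4
    by (metis finite_imageI imageI le_trans order_less_le_trans zero_less_numeral)
  define F where "F = (\<lambda>z. G z * reflected \<rho> Z n z)"
  have F: "F holomorphic_on UNIV" unfolding F_def using \<rho>1 by (intro holomorphic_intros G) auto
  have "G z \<noteq> 0" if "norm z \<le> \<rho>" for z
  proof (cases "z \<in> Z")
    case False
    then have "g z \<noteq> 0" using that by (simp add: Z_def)
    then show ?thesis by (metis G(3) mult_zero_left)
  qed (use G(2) in blast)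
  moreover have refl_nz: "reflected \<rho> Z n z \<noteq> 0" if "norm z < \<rho>" for z
    using reflected_nonzero[of z \<rho> Z n] that Z fZ \<rho>1 by simp
  ultimately have Fnz: "F z \<noteq> 0" if "norm z < \<rho>" for z
    using that by (simp add: F_def)
  obtain h where h: "h holomorphic_on ball 0 \<rho>" "\<And>z. z \<in> ball 0 \<rho> \<Longrightarrow> exp (h z) = F z"
    using holomorphic_logarithm_exists[OF convex_ball open_ball holomorphic_on_subset[OF F subset_UNIV], of 0 \<rho> 0]
      Fnz \<rho>1 by auto
  have nF: "norm (F z) = exp (Re (h z))" if "norm z < \<rho>" for z
    using h(2)[of z] that by (simp flip: norm_exp_eq_Re)
  \<comment> \<open>On the circle of radius \<open>\<rho>\<close> the moduli of \<open>F\<close> and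
    \<open>g\<close> agree, and \<open>\<rho> \<le> R^4\<close>, so the growth bound passes inside
    by the maximum principle.\<close>
  have "Re (h z) \<le> L" if "norm z < \<rho>" for z
  proof -
    have "norm (F z) \<le> exp L"
    proof (rule max_modulus_cball[OF F])
      show "norm (F w) \<le> exp L" if "norm (w - 0) = \<rho>" for w
        using L[of w] that norm_reflected_sphere[of w \<rho> Z n] \<rho>1 \<rho>\<rho> by (simp add: norm_mult F_def G(3))
    qed (use that \<rho>1 in auto)
    then show ?thesis by (simp add: nF[OF that])
  qed
  moreover have "ln (norm (g 0)) \<le> Re (h 0)"
  proof -
    have "norm (g 0) \<le> norm (F 0)"
      unfolding G(3) F_def norm_mult using \<rho>1 by (intro mult_left_mono norm_reflected_ge Z) auto
    then have "norm (g 0) \<le> exp (Re (h 0))" using nF[of 0] \<rho>1 by simp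
    then have "ln (norm (g 0)) \<le> ln (exp (Re (h 0)))" using g0 by (subst ln_le_cancel_iff) auto
    then show ?thesis by simp
  qed
  \<comment> \<open>The summand 1 in \<open>A\<close> supplies the strict inequality that
    Borel-Caratheodory asks for.\<close>
  ultimately have Re_lt: "Re (h z) - Re (h 0) < A" if "norm z < \<rho>" for z
    using that by (force simp: A_def)
  have A: "A > 0" using lnA by (simp add: A_def)
  have h_near: "norm (h z - h 0) \<le> 8 * A * K / R" if "norm z \<le> 2 * K * R" for z
  proof -
    have z: "norm z \<le> \<rho> / 2" using that \<rho>R by simp
    have "norm (h z - h 0) \<le> 2 * A * norm z / (\<rho> - norm z)"
      using z \<rho>1 by (intro borel_caratheodory[OF h(1) Re_lt]) auto
    also have "\<dots> \<le> 2 * A * (2 * K * R) / (\<rho> / 2)"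
      using z that A K R4 \<rho>1 by (intro frac_le mult_left_mono mult_nonneg_nonneg) auto
    also have "\<dots> = 8 * A * K / R" using R4 by (simp add: \<rho>_def power2_eq_square)
    finally show ?thesis .
  qed
  define B where "B = 3 * (1 + 4 * (K + 1) * (real N + 1))"
  have B0: "B \<ge> 0" using K by (simp add: B_def)
  have "norm (g w') \<le> exp (16 * A * K / R) * B ^ N * norm (g w)"
    if w: "norm w = r" and w': "norm w' \<le> K * r" for w w'
  proof -
    have "1 * (2 * R) \<le> K * (2 * R)" using K R4 by (intro mult_right_mono) auto
    then have wK: "norm w \<le> 2 * K * R" using w r(2) by simp
    have "K * r \<le> K * (2 * R)" using r(2) K by (intro mult_left_mono) auto
    then have w'K: "norm w' \<le> 2 * K * R" using w' by simp
    have w2: "norm w \<le> \<rho> / 2" "norm w' \<le> \<rho> / 2" using wK w'K \<rho>R by auto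
    have lt: "norm w < \<rho>" "norm w' < \<rho>" using w2 \<rho>1 by auto
    define q where "q = (\<lambda>a z. (of_real (\<rho>\<^sup>2) - cnj a * z) / of_real \<rho> :: complex)"
    \<comment> \<open>The price \<open>B\<close> of one zero: the distances to \<open>a\<close> have
      ratio at most \<open>1 + 4 * (K + 1) * (N + 1)\<close> because the circle of radius
      \<open>r\<close> avoids \<open>a\<close>, and the reflected factors, lying between
      \<open>\<rho> / 2\<close> and \<open>3 / 2 * \<rho>\<close>, contribute the 3.\<close>
    have factor: "norm (w' - a) * norm (q a w) \<le> B * (norm (w - a) * norm (q a w'))" if a: "a \<in> Z" for a
    proof -
      have na: "norm a \<le> \<rho>" using a Z by auto
      have aw: "norm (cnj a * z) \<le> \<rho> * (\<rho> / 2)" if "norm z \<le> \<rho> / 2" for z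
        unfolding norm_mult complex_mod_cnj using na that \<rho>1 by (intro mult_mono) auto
      have up: "norm (q a w) \<le> 3 / 2 * \<rho>"
      proof -
        have "norm (of_real (\<rho>\<^sup>2) - cnj a * w) \<le> \<rho>\<^sup>2 + \<rho> * (\<rho> / 2)"
          using norm_triangle_ineq4[of "of_real (\<rho>\<^sup>2)" "cnj a * w"] aw[OF w2(1)]
          by (simp add: norm_power)
        then show ?thesis using \<rho>1 by (simp add: q_def norm_divide divide_le_eq power2_eq_square)
      qed
      have lo: "\<rho> / 2 \<le> norm (q a w')"
      proof -
        have "\<rho>\<^sup>2 - \<rho> * (\<rho> / 2) \<le> norm (of_real (\<rho>\<^sup>2) - cnj a * w')"
          using norm_triangle_ineq2[of "of_real (\<rho>\<^sup>2)" "cnj a * w'"] aw[OF w2(2)]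
          by (simp add: norm_power)
        then show ?thesis using \<rho>1 by (simp add: q_def norm_divide le_divide_eq power2_eq_square)
      qed
      have "R / (2 * (real N + 1)) \<le> norm (w - a)"
        using r(3)[OF a] norm_triangle_ineq3[of w a] w by linarith
      then have d: "R \<le> 2 * (real N + 1) * norm (w - a)" by (simp add: field_simps)
      have "norm (w' - a) \<le> norm (w' - w) + norm (w - a)"
        using norm_triangle_ineq[of "w' - w" "w - a"] by simp
      also have "norm (w' - w) \<le> K * r + r" using norm_triangle_ineq4[of w' w] w w' by linarith
      also have "K * r + r \<le> 2 * (K + 1) * R"
        using mult_left_mono[OF r(2), of "K + 1"] K by (simp add: algebra_simps)
      also have "\<dots> \<le> 2 * (K + 1) * (2 * (real N + 1) * norm (w - a))"
        using d K by (intro mult_left_mono) auto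
      finally have "norm (w' - a) \<le> (1 + 4 * (K + 1) * (real N + 1)) * norm (w - a)"
        by (simp add: algebra_simps)
      moreover have "norm (q a w) \<le> 3 * norm (q a w')" using up lo by linarith
      ultimately have "norm (w' - a) * norm (q a w) \<le>
          ((1 + 4 * (K + 1) * (real N + 1)) * norm (w - a)) * (3 * norm (q a w'))"
        using K by (intro mult_mono) auto
      then show ?thesis unfolding B_def by (simp only: mult_ac)
    qed
    have refl: "norm (reflected \<rho> Z n z) = (\<Prod>a\<in>Z. norm (q a z) ^ n a)" for z
      by (simp add: reflected_def q_def prod_norm[symmetric] norm_power)
    define b where "b = (\<lambda>z. \<Prod>a\<in>Z. norm (z - a) ^ n a)"
    have ng: "norm (g z) = norm (G z) * b z" for z
      by (simp add: G(3) b_def norm_mult prod_norm[symmetric] norm_power)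
    have "b w' * norm (reflected \<rho> Z n w) = (\<Prod>a\<in>Z. (norm (w' - a) * norm (q a w)) ^ n a)"
      by (simp add: b_def refl power_mult_distrib prod.distrib)
    also have "\<dots> \<le> (\<Prod>a\<in>Z. (B * (norm (w - a) * norm (q a w'))) ^ n a)"
      by (intro prod_mono conjI power_mono factor) auto
    also have "\<dots> = B ^ N * (b w * norm (reflected \<rho> Z n w'))"
      by (simp add: b_def refl power_mult_distrib prod.distrib N_def power_sum)
    finally have b: "b w' * norm (reflected \<rho> Z n w) \<le> B ^ N * (b w * norm (reflected \<rho> Z n w'))" .
    have "Re (h w') - Re (h w) \<le> 16 * A * K / R"
      using h_near[OF wK] h_near[OF w'K] abs_Re_le_cmod[of "h w - h 0"] abs_Re_le_cmod[of "h w' - h 0"]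
      by simp
    then have "norm (F w') \<le> exp (16 * A * K / R + Re (h w))"
      using lt by (simp add: nF)
    then have Fle: "norm (F w') \<le> exp (16 * A * K / R) * norm (F w)"
      using lt by (simp add: nF exp_add)
    \<comment> \<open>Multiplying by both reflected products separates the zero-free part
      \<open>F\<close> from the zeros; the products are nonzero and cancel at the end.\<close>
    have "norm (g w') * (norm (reflected \<rho> Z n w) * norm (reflected \<rho> Z n w')) =
        norm (F w') * (b w' * norm (reflected \<rho> Z n w))"
      by (simp add: ng F_def norm_mult mult_ac)
    also have "\<dots> \<le> (exp (16 * A * K / R) * norm (F w)) * (B ^ N * (b w * norm (reflected \<rho> Z n w')))"
      by (rule mult_mono[OF Fle b]) (auto simp: b_def intro!: prod_nonneg mult_nonneg_nonneg)
    also have "\<dots> = (exp (16 * A * K / R) * B ^ N * norm (g w)) * (norm (reflected \<rho> Z n w) * norm (reflected \<rho> Z n w'))"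
      by (simp add: ng F_def norm_mult mult_ac)
    finally show ?thesis using refl_nz[OF lt(1)] refl_nz[OF lt(2)] by simp
  qed
  then show ?thesis using r N unfolding B_def by blast
qed

text \<open>Growth exponent \<open>s + 1\<close> leaves \<open>O((ln R)^s)\<close> zeros, each
  costing \<open>O(ln (ln R))\<close> in the exponent; the gap between \<open>s\<close> and
  \<open>t\<close> absorbs this logarithm.\<close>

lemma quotient_growth:
  fixes g :: "complex \<Rightarrow> complex"
  assumes g: "g holomorphic_on UNIV" and g0: "g 0 \<noteq> 0" and K: "K \<ge> 1" and st: "0 < s" "s < t"
    and gr: "\<forall>\<^sub>F r in at_top. \<forall>z. norm z \<le> r \<longrightarrow> norm (g z) \<le> exp (ln r powr (s + 1))"
  shows "\<forall>\<^sub>F R in at_top. \<exists>r\<ge>R. r \<le> 2 * R \<and> (\<forall>w w'. norm w = r \<longrightarrow> norm w' \<le> K * r \<longrightarrow>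
     norm (g w') \<le> exp (ln R powr t) * norm (g w))"
proof -
  define c where "c = 1 - ln (norm (g 0))"
  \<comment> \<open>The bound on the number \<open>N\<close> of zeros for
    \<open>L = (4 * ln R) powr (s + 1)\<close>, where \<open>4 * ln R = ln (R^4)\<close>.\<close>
  define X where "X = (\<lambda>R::real. ((4 * ln R) powr (s + 1) + c) / (2 * ln R))"
  have "filterlim (\<lambda>R::real. R ^ 4) at_top at_top" by real_asymp
  then have gr4: "\<forall>\<^sub>F R in at_top. \<forall>z. norm z \<le> R ^ 4 \<longrightarrow> norm (g z) \<le> exp (ln (R ^ 4) powr (s + 1))"
    using gr by (rule eventually_compose_filterlim[rotated])
  have asym: "\<forall>\<^sub>F R in at_top. 16 * ((4 * ln R) powr (s+1) + c) * K / R +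
      X R * ln (3 * (1 + 4 * (K + 1) * (X R + 1))) \<le> ln R powr t"
    unfolding X_def using st K by real_asymp
  show ?thesis using gr4 asym eventually_ge_at_top[of "4 * K"]
  proof eventually_elim
    case (elim R)
    have R: "R \<ge> 4" using elim(3) K by linarith
    define L where "L = (4 * ln R) powr (s + 1)"
    have "norm (g z) \<le> exp L" if "norm z \<le> R ^ 4" for z
      using elim(1) that R by (simp add: L_def ln_realpow)
    then obtain r N where r: "R \<le> r" "r \<le> 2 * R" "real N * (2 * ln R) \<le> L + c"
      "\<And>w w'. norm w = r \<Longrightarrow> norm w' \<le> K * r \<Longrightarrow>
       norm (g w') \<le> exp (16 * (L + c) * K / R) * (3 * (1 + 4 * (K + 1) * (real N + 1))) ^ N * norm (g w)"
      using quotient_bound[OF g g0 K elim(3), of L] by (auto simp: c_def algebra_simps)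
    have "ln R > 0" using R by simp
    then have NX: "real N \<le> X R" using r(3) by (simp add: X_def L_def field_simps)
    define B where "B = (\<lambda>x::real. 3 * (1 + 4 * (K + 1) * (x + 1)))"
    have "4 * (K + 1) * (real N + 1) \<ge> 0" using K by simp
    then have B1: "B N \<ge> 1" by (simp add: B_def)
    have "4 * (K + 1) * (real N + 1) \<le> 4 * (K + 1) * (X R + 1)"
      using NX K by (intro mult_left_mono) auto
    then have BB: "B N \<le> B (X R)" by (simp add: B_def)
    have "B N ^ N = exp (real N * ln (B N))" using B1 by (simp add: exp_of_nat_mult)
    also have "\<dots> \<le> exp (X R * ln (B (X R)))"
      using NX BB B1 by (subst exp_le_cancel_iff, intro mult_mono) auto
    finally have "exp (16 * (L + c) * K / R) * B N ^ N \<le> exp (16 * (L + c) * K / R + X R * ln (B (X R)))"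
      by (simp add: exp_add)
    also have "\<dots> \<le> exp (ln R powr t)" using elim(2) by (simp add: B_def L_def)
    finally have fin: "exp (16 * (L + c) * K / R) * B N ^ N \<le> exp (ln R powr t)" .
    show ?case
    proof (intro exI[of _ r] conjI allI impI)
      fix w w' :: complex assume w: "norm w = r" "norm w' \<le> K * r"
      have "norm (g w') \<le> exp (16 * (L + c) * K / R) * B N ^ N * norm (g w)"
        using r(4)[OF w] by (simp add: B_def)
      also have "\<dots> \<le> exp (ln R powr t) * norm (g w)" using fin by (intro mult_right_mono) auto
      finally show "norm (g w') \<le> exp (ln R powr t) * norm (g w)" .
    qed (use r in auto)
  qed
qed

section \<open>Logarithmic order and iterated Hahn differences\<close>

text \<open>The characteristic controls the maximum modulus only up to the factor 3 and a radius
  somewhere in \<open>[2r, 3r]\<close>. An intermediate exponent \<open>s\<close> absorbs both, as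
  its bound holds at all large radii.\<close>

lemma log_order_less_imp_growth:
  assumes f: "f holomorphic_on UNIV" and lt: "log_order f < ereal t" and t: "t > 0"
  shows "\<forall>\<^sub>F r in at_top. \<forall>z. norm z \<le> r \<longrightarrow> norm (f z) \<le> exp (ln r powr t)"
proof -
  \<comment> \<open>The maximum with 0 yields a positive \<open>s\<close>, making
    \<open>ln r powr s\<close> increasing.\<close>
  have "max 0 (log_order f) < ereal t" using lt t by simp
  then obtain s where s: "max 0 (log_order f) < ereal s" "ereal s < ereal t"
    using ereal_dense2 by blast
  then have s0: "0 < s" "s < t" "log_order f < ereal s" by auto
  have "\<forall>\<^sub>F r in at_top. ereal (log_plus (nevanlinna_T r f) / ln (ln r)) < ereal s"
    using s0(3) unfolding log_order_def by (rule Limsup_lessD)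
  then have "\<forall>\<^sub>F r in at_top. nevanlinna_T r f \<le> ln r powr s"
    using eventually_gt_at_top[of "exp 1"]
  proof eventually_elim
    case (elim r)
    have r0: "r > 0" using elim(2) by (rule less_trans[OF exp_gt_zero])
    have lr: "ln r > 1" using elim(2) r0 by (metis exp_gt_zero ln_exp ln_less_cancel_iff)
    have "log_plus (nevanlinna_T r f) < s * ln (ln r)"
      using elim(1) lr by (simp add: divide_less_eq)
    then have "exp (log_plus (nevanlinna_T r f)) \<le> exp (s * ln (ln r))" by simp
    then show ?case using lr by (simp add: log_plus_def powr_def)
  qed
  then obtain R0 where R0: "\<And>r. r \<ge> R0 \<Longrightarrow> nevanlinna_T r f \<le> ln r powr s"
    unfolding eventually_at_top_linorder by blast
  have "\<forall>\<^sub>F r::real in at_top. 3 * (ln (3*r)) powr s \<le> (ln r) powr t"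
    using s0 by real_asymp
  then show ?thesis using eventually_ge_at_top[of R0] eventually_ge_at_top[of 1]
  proof eventually_elim
    case (elim r)
    obtain R where R: "2 * r \<le> R" "R \<le> 3 * r" "\<And>z. norm z \<le> r \<Longrightarrow> norm (f z) \<le> exp (3 * nevanlinna_T R f)"
      using norm_le_exp_nevanlinna_T[OF f, of r] elim by fastforce
    have "3 * nevanlinna_T R f \<le> 3 * ln R powr s" using R0[of R] R elim by simp
    also have "\<dots> \<le> 3 * ln (3 * r) powr s" using R elim s0 by (intro mult_left_mono powr_mono2) auto
    also have "\<dots> \<le> ln r powr t" by (rule elim)
    finally show ?case using R(3) by (meson exp_le_cancel_iff order_trans)
  qed
qed

lemma log_order_le:
  assumes f: "f holomorphic_on UNIV" and t: "t \<ge> 0"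
    and gr: "\<forall>\<^sub>F r in at_top. \<forall>z. norm z = r \<longrightarrow> norm (f z) \<le> exp (ln r powr t)"
  shows "log_order f \<le> ereal t"
  unfolding log_order_def
proof (rule Limsup_bounded)
  show "\<forall>\<^sub>F r in at_top. ereal (log_plus (nevanlinna_T r f) / ln (ln r)) \<le> ereal t"
    using gr eventually_gt_at_top[of "exp 1"]
  proof eventually_elim
    case (elim r)
    have r0: "r > 0" using elim(2) by (rule less_trans[OF exp_gt_zero])
    have lr: "ln r > 1" using elim(2) r0 by (metis exp_gt_zero ln_exp ln_less_cancel_iff)
    have "nevanlinna_T r f \<le> ln r powr t"
      using elim(1) r0 by (intro nevanlinna_T_le[OF f]) auto
    moreover have "1 \<le> ln r powr t" using lr t by (intro ge_one_powr_ge_zero) auto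
    ultimately have "ln (max 1 (nevanlinna_T r f)) \<le> ln (ln r powr t)"
      by (subst ln_le_cancel_iff) auto
    also have "\<dots> = t * ln (ln r)" using lr by (simp add: ln_powr)
    finally show ?case using lr by (simp add: log_plus_def divide_le_eq)
  qed
qed

section \<open>Iterated Hahn differences away from the fixed point\<close>

lemma hahn_off_fixed_point:
  assumes f: "f holomorphic_on {z. (q - 1) * z + c \<noteq> 0}" and q: "q \<noteq> 0"
  shows "(q - 1) * z + c \<noteq> 0 \<Longrightarrow> hahn q c f z = (f (q * z + c) - f z) / ((q - 1) * z + c)" (is "_ \<Longrightarrow> ?eq")
    and "hahn q c f holomorphic_on {z. (q - 1) * z + c \<noteq> 0}" (is ?hol)
proof -
  define S where "S = {z. (q - 1) * z + c \<noteq> 0}"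
  have S: "open S"
    unfolding S_def by (intro open_Collect_neq continuous_intros)
  \<comment> \<open>The map multiplies the denominator by \<open>q\<close>, so the set
    \<open>S\<close> where it is nonzero is invariant. On \<open>S\<close> the quotient is already
    analytic and \<open>remove_sings\<close> changes nothing.\<close>
  have "(q - 1) * (q * z + c) + c = q * ((q - 1) * z + c)" for z by (simp add: algebra_simps)
  then have im: "(\<lambda>z. q * z + c) ` S \<subseteq> S" using q by (auto simp: S_def)
  have "(\<lambda>z. f (q * z + c)) holomorphic_on S"
    by (rule holomorphic_on_compose_gen[OF _ f[folded S_def] im, unfolded o_def]) (intro holomorphic_intros)
  then have hol: "(\<lambda>z. (f (q * z + c) - f z) / ((q - 1) * z + c)) holomorphic_on S"
    using f[folded S_def] by (intro holomorphic_intros) (auto simp: S_def)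
  then have eq: "hahn q c f z = (f (q * z + c) - f z) / ((q - 1) * z + c)" if "z \<in> S" for z
    unfolding hahn_def using that S analytic_on_open analytic_on_subset
    by (intro remove_sings_at_analytic) blast
  show ?eq if "(q - 1) * z + c \<noteq> 0" using eq that by (simp add: S_def)
  show ?hol using holomorphic_transform[OF hol] eq unfolding S_def by metis
qed

lemma hahn_funpow_holomorphic:
  assumes "g holomorphic_on UNIV" and q: "q \<noteq> 0"
  shows "(hahn q c ^^ j) g holomorphic_on {z. (q - 1) * z + c \<noteq> 0}"
proof (induction j)
  case 0
  show ?case using assms(1) holomorphic_on_subset by auto
next
  case (Suc j)
  show ?case using hahn_off_fixed_point(2)[OF Suc q] by simp
qed

text \<open>With denominators of modulus at least 1 along the orbit, each difference at most doubles
  the bound, and only values of \<open>g\<close> on the orbit enter.\<close>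

lemma norm_hahn_funpow_le:
  assumes g: "g holomorphic_on UNIV" and q: "q \<noteq> 0"
    and "\<And>i. i \<le> j \<Longrightarrow> 1 \<le> norm ((q - 1) * ((\<lambda>z. q * z + c) ^^ i) z + c)"
    and "\<And>i. i \<le> j \<Longrightarrow> norm (g (((\<lambda>z. q * z + c) ^^ i) z)) \<le> X"
  shows "norm ((hahn q c ^^ j) g z) \<le> 2 ^ j * X"
  using assms(3,4)
proof (induction j arbitrary: z)
  case 0
  then show ?case by simp
next
  case (Suc j)
  let ?\<phi> = "\<lambda>z. q * z + c"
  have d: "1 \<le> norm ((q - 1) * z + c)" using Suc.prems(1)[of 0] by simp
  then have "(q - 1) * z + c \<noteq> 0" by auto
  then have "(hahn q c ^^ Suc j) g z = ((hahn q c ^^ j) g (q * z + c) - (hahn q c ^^ j) g z) / ((q - 1) * z + c)"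
    using hahn_off_fixed_point(1)[OF hahn_funpow_holomorphic[OF g q] q] by simp
  then have "norm ((hahn q c ^^ Suc j) g z) = norm ((hahn q c ^^ j) g (q * z + c) - (hahn q c ^^ j) g z) / norm ((q - 1) * z + c)"
    by (simp only: norm_divide)
  also have "\<dots> \<le> norm ((hahn q c ^^ j) g (q * z + c) - (hahn q c ^^ j) g z)"
    using frac_le[OF norm_ge_zero order_refl zero_less_one d, of "(hahn q c ^^ j) g (q * z + c) - (hahn q c ^^ j) g z"]
    by (simp only: div_by_1)
  also have "\<dots> \<le> norm ((hahn q c ^^ j) g (q * z + c)) + norm ((hahn q c ^^ j) g z)"
    by (rule norm_triangle_ineq4)
  also have "norm ((hahn q c ^^ j) g (q * z + c)) \<le> 2 ^ j * X"
  proof (rule Suc.IH)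
    fix i assume "i \<le> j"
    moreover have "(?\<phi> ^^ i) (q * z + c) = (?\<phi> ^^ Suc i) z" by (simp only: funpow_Suc_right o_def)
    ultimately show "1 \<le> norm ((q - 1) * (?\<phi> ^^ i) (q * z + c) + c)" "norm (g ((?\<phi> ^^ i) (q * z + c))) \<le> X"
      using Suc.prems(1)[of "Suc i"] Suc.prems(2)[of "Suc i"] by (simp_all only: Suc_le_mono)
  qed
  also have "norm ((hahn q c ^^ j) g z) \<le> 2 ^ j * X"
    using Suc.prems by (intro Suc.IH) auto
  finally show ?case by (simp add: mult_ac)
qed

text \<open>Along an orbit the denominator only picks up powers of \<open>q\<close>, so a large
  value at \<open>z\<close> keeps it large for boundedly many steps.\<close>

lemma affine_funpow:
  "(q - 1) * ((\<lambda>z. q * z + c) ^^ i) z + c = q ^ i * ((q - 1) * z + c)" for q c z :: "'a::comm_ring_1"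
proof (induction i)
  case (Suc i)
  have "(q - 1) * ((\<lambda>z. q * z + c) ^^ Suc i) z + c = q * ((q - 1) * ((\<lambda>z. q * z + c) ^^ i) z + c)"
    by (simp add: algebra_simps)
  then show ?case by (simp add: Suc)
qed simp

text \<open>Adding 1 to the norms absorbs the translation \<open>c\<close> and makes the recursion
  purely multiplicative.\<close>

lemma norm_affine_funpow_le:
  "norm (((\<lambda>z. q * z + c) ^^ i) z) + 1 \<le> (norm q + norm c + 1) ^ i * (norm z + 1)" for q c z :: complex
proof (induction i)
  case (Suc i)
  let ?w = "((\<lambda>z. q * z + c) ^^ i) z" and ?Q = "norm q + norm c + 1"
  have "norm (q * ?w + c) + 1 \<le> norm q * norm ?w + norm c + 1"
    using norm_triangle_ineq[of "q * ?w" c] by (simp add: norm_mult)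
  also have "\<dots> \<le> ?Q * (norm ?w + 1)" by (simp add: algebra_simps)
  also have "\<dots> \<le> ?Q * (?Q ^ i * (norm z + 1))" using Suc by (intro mult_left_mono) auto
  finally show ?case by (simp add: mult.assoc)
qed simp

section \<open>Solving the difference equation for the dominant coefficient\<close>

theorem theorem4:
  fixes k :: nat and q c :: complex
    and A :: "nat \<Rightarrow> complex \<Rightarrow> complex" and g :: "complex \<Rightarrow> complex"
  assumes "k \<ge> 2"
    and "norm q \<noteq> 0" and "norm q \<noteq> 1"
    and "\<And>j. j < k \<Longrightarrow> A j holomorphic_on UNIV"
    and "\<And>j. j < k \<Longrightarrow> growth_order (A j) = 0"
    and "\<And>j. j \<in> {1..<k} \<Longrightarrow> log_order (A j) < log_order (A 0)"
    and "\<And>j. j \<in> {1..<k} \<Longrightarrow> 1 \<le> log_order (A j)"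
    and "g holomorphic_on UNIV"
    and "\<exists>z. g z \<noteq> 0"
    and "\<And>z. (hahn q c ^^ k) g z + (\<Sum>j<k. A j z * (hahn q c ^^ j) g z) = 0"
  shows "log_order g \<ge> log_order (A 0) + 1"
proof (rule ccontr)
  assume "\<not> log_order g \<ge> log_order (A 0) + 1"
  then have lt: "log_order g < log_order (A 0) + 1" by simp
  have q: "q \<noteq> 0" "q \<noteq> 1" using assms(2,3) by auto
  \<comment> \<open>The quantities to be kept below \<open>log_order (A 0)\<close>. In the chain
    \<open>M < \<tau> < s < t1 < t < log_order (A 0)\<close>, \<open>\<tau>\<close> bounds the other
    coefficients and \<open>\<tau> + 1\<close> bounds \<open>g\<close>, \<open>s\<close> pays for
    moving the centre, \<open>t1\<close> for the quotients, and \<open>t\<close> is the final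
    exponent for \<open>A 0\<close>.\<close>
  define M where "M = Max (insert (log_order g - 1) ((\<lambda>j. log_order (A j)) ` {1..<k}))"
  have "log_order g - 1 < log_order (A 0)"
    using lt by (subst ereal_minus_less) auto
  then have "M < log_order (A 0)" unfolding M_def using assms(6) by (subst Max_less_iff) auto
  then obtain \<tau> where \<tau>: "M < ereal \<tau>" "ereal \<tau> < log_order (A 0)" using ereal_dense2 by blast
  obtain t where t: "ereal \<tau> < ereal t" "ereal t < log_order (A 0)" using ereal_dense2[OF \<tau>(2)] by blast
  have \<tau>A: "log_order (A j) < ereal \<tau>" if "j \<in> {1..<k}" for j
    using \<tau>(1) that unfolding M_def by (subst (asm) Max_less_iff) auto
  have "log_order g - 1 < ereal \<tau>"
    using \<tau>(1) unfolding M_def by (subst (asm) Max_less_iff) auto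
  then have "log_order g < ereal \<tau> + 1"
    by (subst (asm) ereal_minus_less) auto
  then have \<tau>g: "log_order g < ereal (\<tau> + 1)" by (simp add: one_ereal_def)
  \<comment> \<open>Index 1 is available because \<open>k \<ge> 2\<close>; all exponents chosen
    below exceed 1.\<close>
  have "1 < ereal \<tau>" using le_less_trans[OF assms(7)[of 1] \<tau>A[of 1]] assms(1) by simp
  then have \<tau>1: "\<tau> > 1" by (simp add: one_ereal_def)
  have "\<tau> < t" using t(1) by simp
  then obtain t1 where t1: "\<tau> < t1" "t1 < t" using dense by blast
  obtain s where s: "\<tau> < s" "s < t1" using dense[OF t1(1)] by blast
  note st = s t1(2)

  \<comment> \<open>The quotient estimate needs a nonzero value at the centre, and \<open>g\<close>
    may vanish at 0; hence the translation.\<close>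
  obtain z0 where z0: "g z0 \<noteq> 0" using assms(9) by blast
  define G where "G = (\<lambda>w. g (z0 + w))"
  have G: "G holomorphic_on UNIV"
    unfolding G_def
    by (rule holomorphic_on_compose_gen[OF _ assms(8), unfolded o_def]) (auto intro!: holomorphic_intros)
  define \<phi> where "\<phi> = (\<lambda>z. q * z + c)"
  define Q where "Q = norm q + norm c + 1"
  \<comment> \<open>\<open>K * r\<close> will bound the distance from \<open>z0\<close> to the first
    \<open>k\<close> iterates of a point on the circle. Below, \<open>m\<close> is a lower bound for
    \<open>norm q ^ i\<close> with \<open>i \<le> k\<close>, whether \<open>norm q\<close> is above
    or below 1, and \<open>b\<close> counts terms times the doubling factor of the
    differences.\<close>
  define K where "K = 2 * Q ^ k + 1"
  define m where "m = min 1 (norm q) ^ k"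
  define b where "b = (1 + real k) * 2 ^ k"
  have Q1: "Q \<ge> 1" by (simp add: Q_def)
  have K1: "K \<ge> 1" using Q1 by (simp add: K_def)
  have m0: "m > 0" using q by (simp add: m_def)
  have b0: "b > 0" by (simp add: b_def)

  have "\<forall>\<^sub>F r in at_top. \<forall>w. norm w \<le> r \<longrightarrow> norm (G w) \<le> exp (ln r powr (s + 1))"
  proof -
    have g1: "\<forall>\<^sub>F r in at_top. \<forall>z. norm z \<le> r \<longrightarrow> norm (g z) \<le> exp (ln r powr (\<tau> + 1))"
      using \<tau>1 by (intro log_order_less_imp_growth[OF assms(8) \<tau>g]) auto
    have "filterlim (\<lambda>r::real. 2 * r) at_top at_top" by real_asymp
    with g1 have "\<forall>\<^sub>F r in at_top. \<forall>z. norm z \<le> 2 * r \<longrightarrow> norm (g z) \<le> exp (ln (2 * r) powr (\<tau> + 1))"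
      by (rule eventually_compose_filterlim)
    moreover have "\<forall>\<^sub>F r::real in at_top. ln (2 * r) powr (\<tau> + 1) \<le> ln r powr (s + 1)"
      using \<tau>1 st by real_asymp
    ultimately show ?thesis using eventually_ge_at_top[of "norm z0"]
    proof eventually_elim
      case (elim r)
      show ?case
      proof (intro allI impI)
        fix w :: complex assume "norm w \<le> r"
        then have "norm (z0 + w) \<le> 2 * r" using norm_triangle_ineq[of z0 w] elim(3) by linarith
        then have "norm (G w) \<le> exp (ln (2 * r) powr (\<tau> + 1))" using elim(1) by (simp add: G_def)
        also have "\<dots> \<le> exp (ln r powr (s + 1))" using elim(2) by simp
        finally show "norm (G w) \<le> exp (ln r powr (s + 1))" .
      qed
    qed
  qed
  then have quot: "\<forall>\<^sub>F R in at_top. \<exists>r\<ge>R. r \<le> 2 * R \<and> (\<forall>w w'. norm w = r \<longrightarrow> norm w' \<le> K * r \<longrightarrow>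
     norm (G w') \<le> exp (ln R powr t1) * norm (G w))"
    using st \<tau>1 z0 by (intro quotient_growth[OF G _ K1]) (auto simp: G_def)
  have "\<forall>\<^sub>F r in at_top. \<forall>j\<in>{1..<k}. \<forall>z. norm z \<le> r \<longrightarrow> norm (A j z) \<le> exp (ln r powr \<tau>)"
    using \<tau>A \<tau>1 assms(4) by (intro eventually_ball_finite ballI log_order_less_imp_growth) auto
  moreover have "filterlim (\<lambda>r::real. 3 * r) at_top at_top" by real_asymp
  ultimately have grA: "\<forall>\<^sub>F R in at_top. \<forall>j\<in>{1..<k}. \<forall>z. norm z \<le> 3 * R \<longrightarrow> norm (A j z) \<le> exp (ln (3 * R) powr \<tau>)"
    by (rule eventually_compose_filterlim)
  \<comment> \<open>The right side involves \<open>R / 2\<close> because the bound from a circle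
    about \<open>z0\<close> is transferred to the disc of radius \<open>R / 2\<close> about
    0.\<close>
  have asym: "\<forall>\<^sub>F R::real in at_top. ln b + ln (3 * R) powr \<tau> + ln R powr t1 \<le> ln (R / 2) powr t"
    using \<tau>1 st by real_asymp
  \<comment> \<open>This keeps all denominators on the orbit at modulus at least 1; it holds
    eventually since \<open>q \<noteq> 1\<close> and \<open>m > 0\<close>.\<close>
  have big: "\<forall>\<^sub>F R::real in at_top. 1 \<le> m * (norm (q - 1) * (R - norm z0) - norm c)"
    using m0 q by real_asymp
  have ev: "\<forall>\<^sub>F R in at_top. \<forall>z. norm z \<le> R / 2 \<longrightarrow> norm (A 0 z) \<le> exp (ln (R / 2) powr t)"
    using quot grA asym big eventually_ge_at_top[of "2 * norm z0 + 2"]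
  proof eventually_elim
    case (elim R)
    have R2: "R \<ge> 2" and Rz0: "norm z0 \<le> R / 2" using elim(5) norm_ge_zero[of z0] by linarith+
    obtain r where r: "R \<le> r" "r \<le> 2 * R" and quo: "\<And>w w'. norm w = r \<Longrightarrow> norm w' \<le> K * r \<Longrightarrow>
       norm (G w') \<le> exp (ln R powr t1) * norm (G w)"
      using elim(1) by blast
    have r0: "r > 0" using r R2 by simp
    have circle: "norm (A 0 z) \<le> exp (ln (R / 2) powr t)" if z: "norm (z - z0) = r" for z
    proof -
      define X where "X = exp (ln R powr t1) * norm (g z)"
      define Y where "Y = exp (ln (3 * R) powr \<tau>)"
      have Y1: "Y \<ge> 1" by (simp add: Y_def)
      have Gz: "G (z - z0) = g z" by (simp add: G_def)
      have nz: "norm z \<le> r + norm z0" using norm_triangle_ineq[of "z - z0" z0] z by simp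
      have gX: "norm (g y) \<le> X" if "norm (y - z0) \<le> K * r" for y
        using quo[OF z that] by (simp add: X_def G_def)
      \<comment> \<open>A zero of \<open>g\<close> on the circle would force \<open>g z0 = 0\<close>
        through the quotient bound. Thus division by \<open>g z\<close> is legitimate.\<close>
      have gz: "norm (g z) > 0"
      proof (rule ccontr)
        assume "\<not> ?thesis"
        then have "X = 0" by (simp add: X_def)
        then show False using gX[of z0] z0 K1 r0 by simp
      qed
      have iter: "norm (g ((\<phi> ^^ i) z)) \<le> X" if "i \<le> k" for i
      proof (rule gX)
        have "norm ((\<phi> ^^ i) z) + 1 \<le> Q ^ i * (norm z + 1)"
          unfolding \<phi>_def Q_def by (rule norm_affine_funpow_le)
        \<comment> \<open>Here \<open>norm z + 1 \<le> r + norm z0 + 1 \<le> 2 * r\<close>, from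
          \<open>R \<ge> 2 * norm z0 + 2\<close>.\<close>
        also have "\<dots> \<le> Q ^ k * (2 * r)"
          using that Q1 nz r elim(5) by (intro mult_mono power_increasing) auto
        finally have "norm ((\<phi> ^^ i) z - z0) \<le> Q ^ k * (2 * r) + norm z0"
          using norm_triangle_ineq4[of "(\<phi> ^^ i) z" z0] by linarith
        also have "\<dots> \<le> K * r" using Rz0 r by (simp add: K_def algebra_simps)
        finally show "norm ((\<phi> ^^ i) z - z0) \<le> K * r" .
      qed
      have far: "1 \<le> norm ((q - 1) * (\<phi> ^^ i) z + c)" if "i \<le> k" for i
      proof -
        have "R - norm z0 \<le> norm z" using norm_triangle_ineq4[of z z0] z r by linarith
        then have "norm (q - 1) * (R - norm z0) - norm c \<le> norm (q - 1) * norm z - norm c"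
          by (intro diff_right_mono mult_left_mono) auto
        also have "\<dots> \<le> norm ((q - 1) * z + c)"
          using norm_triangle_ineq2[of "(q - 1) * z" "- c"] by (simp add: norm_mult)
        finally have lo: "norm (q - 1) * (R - norm z0) - norm c \<le> norm ((q - 1) * z + c)" .
        have "m \<le> min 1 (norm q) ^ i" unfolding m_def using that by (intro power_decreasing) auto
        also have "\<dots> \<le> norm q ^ i" by (intro power_mono) auto
        finally have "m \<le> norm q ^ i" .
        have "1 \<le> m * (norm (q - 1) * (R - norm z0) - norm c)" by (rule elim(4))
        also have "\<dots> \<le> m * norm ((q - 1) * z + c)" using lo m0 by (intro mult_left_mono) auto
        also have "\<dots> \<le> norm q ^ i * norm ((q - 1) * z + c)"
          using \<open>m \<le> norm q ^ i\<close> by (intro mult_right_mono) auto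
        finally show ?thesis unfolding \<phi>_def affine_funpow by (simp add: norm_mult norm_power)
      qed
      have X0: "X \<ge> 0" by (simp add: X_def)
      have D: "norm ((hahn q c ^^ j) g z) \<le> 2 ^ k * X" if "j \<le> k" for j
      proof -
        have "norm ((hahn q c ^^ j) g z) \<le> 2 ^ j * X"
          using far iter that unfolding \<phi>_def by (intro norm_hahn_funpow_le assms(8) q) auto
        also have "\<dots> \<le> 2 ^ k * X" using that X0 by (intro mult_right_mono power_increasing) auto
        finally show ?thesis .
      qed
      have "{..<k} = insert 0 {1..<k}" using assms(1) by auto
      then have "(\<Sum>j<k. A j z * (hahn q c ^^ j) g z) = A 0 z * g z + (\<Sum>j\<in>{1..<k}. A j z * (hahn q c ^^ j) g z)"
        by simp
      then have "A 0 z * g z = - ((hahn q c ^^ k) g z + (\<Sum>j\<in>{1..<k}. A j z * (hahn q c ^^ j) g z))"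
        using assms(10)[of z] by (simp add: algebra_simps eq_neg_iff_add_eq_0)
      then have "norm (A 0 z) * norm (g z) =
          norm ((hahn q c ^^ k) g z + (\<Sum>j\<in>{1..<k}. A j z * (hahn q c ^^ j) g z))"
        by (metis norm_minus_cancel norm_mult)
      also have "\<dots> \<le> norm ((hahn q c ^^ k) g z) + (\<Sum>j\<in>{1..<k}. norm (A j z * (hahn q c ^^ j) g z))"
        by (intro order_trans[OF norm_triangle_ineq] add_left_mono norm_sum)
      \<comment> \<open>Since \<open>Y \<ge> 1\<close>, the term of order \<open>k\<close>, whose
        coefficient is 1, obeys the same bound as the others.\<close>
      also have "\<dots> \<le> Y * (2 ^ k * X) + (\<Sum>j\<in>{1..<k}. Y * (2 ^ k * X))"
      proof (intro add_mono sum_mono)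
        show "norm ((hahn q c ^^ k) g z) \<le> Y * (2 ^ k * X)"
          using D[OF order_refl] mult_right_mono[OF Y1, of "2 ^ k * X"] X0
          by (metis mult_1 mult_nonneg_nonneg order_trans zero_le_numeral zero_le_power)
        show "norm (A j z * (hahn q c ^^ j) g z) \<le> Y * (2 ^ k * X)" if "j \<in> {1..<k}" for j
          unfolding norm_mult
        proof (intro mult_mono D)
          have "norm z \<le> 3 * R" using nz r Rz0 R2 by linarith
          then show "norm (A j z) \<le> Y" using elim(2) that by (simp add: Y_def)
        qed (use that Y1 in auto)
      qed
      also have "\<dots> = real (1 + (k - 1)) * (Y * (2 ^ k * X))" by (simp add: algebra_simps)
      also have "\<dots> \<le> (1 + real k) * (Y * (2 ^ k * X))"
        using X0 Y1 by (intro mult_right_mono) auto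
      also have "\<dots> = exp (ln b + ln (3 * R) powr \<tau> + ln R powr t1) * norm (g z)"
        using b0 by (simp add: exp_add b_def X_def Y_def mult_ac)
      finally have "norm (A 0 z) \<le> exp (ln b + ln (3 * R) powr \<tau> + ln R powr t1)"
        using gz by (simp only: mult_le_cancel_right_pos)
      also have "\<dots> \<le> exp (ln (R / 2) powr t)" using elim(3) by simp
      finally show ?thesis .
    qed
    \<comment> \<open>The disc of radius \<open>R / 2\<close> about 0 lies inside the good circle
      about \<open>z0\<close>, so the maximum principle applies.\<close>
    show ?case
    proof (intro allI impI)
      fix z :: complex assume "norm z \<le> R / 2"
      then have "norm (z - z0) \<le> r" using norm_triangle_ineq4[of z z0] Rz0 r by linarith
      then show "norm (A 0 z) \<le> exp (ln (R / 2) powr t)"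
        using assms(1) by (intro max_modulus_cball[OF assms(4) r0 circle]) auto
    qed
  qed
  \<comment> \<open>Putting \<open>R = 2 * r\<close> turns the bound at \<open>R / 2\<close> into
    one at every large radius.\<close>
  have "filterlim (\<lambda>r::real. 2 * r) at_top at_top" by real_asymp
  with ev have "\<forall>\<^sub>F r in at_top. \<forall>z. norm z \<le> 2 * r / 2 \<longrightarrow> norm (A 0 z) \<le> exp (ln (2 * r / 2) powr t)"
    by (rule eventually_compose_filterlim)
  then have "\<forall>\<^sub>F r in at_top. \<forall>z. norm z = r \<longrightarrow> norm (A 0 z) \<le> exp (ln r powr t)"
    by eventually_elim simp
  then have "log_order (A 0) \<le> ereal t"
    using assms(1,4) \<tau>1 st by (intro log_order_le) auto
  then show False using t(2) by simp
qed

end
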